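(* Let $c\in\mathbb{C}$ with $|c|=1$, let $E$ be a complex Banach space, let $I=\mathbb{R}$ or $I=[0,\infty)$, and let $f:I\to E$ be a function that is not identically zero and that is $c$-uniformly recurrent or semi-$c$-periodic. Then $f\notin C_0(I:E)$.
   Context: $\mathbb{N}=\{1,2,\dots\}$; $\mathbb{S}:=\mathbb{N}$ if $I=[0,\infty)$ and $\mathbb{S}:=\mathbb{Z}$ if $I=\mathbb{R}$. $C_0(I:E)$ is the space of all continuous functions $f:I\to E$ with $\lim_{|t|\to+\infty}\|f(t)\|=0$. A continuous function $f:I\to E$ is $c$-uniformly recurrent if there exists a strictly increasing sequence $(\alpha_n)$ of positive reals with $\alpha_n\to+\infty$ and $\lim_{n\to\infty}\sup_{t\in I}\|f(t+\alpha_n)-cf(t)\|=0$. A continuous function $f:I\to E$ is semi-$c$-periodic if for every $\varepsilon>0$ there exists $p>0$ such that $\|f(x+mp)-c^{m}f(x)\|\le\varepsilon$ for all $m\in\mathbb{S}$ and all $x\in I$. *)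

theory Defs
  imports "HOL-Analysis.Analysis"
begin

text \<open>
  A complex Banach space is a complete real normed space with a compatible complex
  scalar multiplication; \<open>1 *\<^sub>C x = x\<close> follows from \<open>scaleR_scaleC\<close>.
\<close>

class complex_banach = banach +
  fixes scaleC :: "complex \<Rightarrow> 'a \<Rightarrow> 'a"  (infixr "*\<^sub>C" 75)
  assumes scaleC_add_right: "a *\<^sub>C (x + y) = a *\<^sub>C x + a *\<^sub>C y"
    and scaleC_add_left: "(a + b) *\<^sub>C x = a *\<^sub>C x + b *\<^sub>C x"
    and scaleC_scaleC: "a *\<^sub>C (b *\<^sub>C x) = (a * b) *\<^sub>C x"
    and scaleR_scaleC: "r *\<^sub>R x = complex_of_real r *\<^sub>C x"
    and norm_scaleC: "norm (a *\<^sub>C x) = cmod a * norm x"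

instantiation complex :: complex_banach
begin

definition scaleC_complex :: "complex \<Rightarrow> complex \<Rightarrow> complex" where
  "scaleC_complex a x = a * x"

instance
  by standard (simp_all add: scaleC_complex_def algebra_simps norm_mult scaleR_conv_of_real)

end

text \<open>
  A function \<open>I \<rightarrow> E\<close> is represented by a total function on the reals of which only
  the values on \<open>I\<close> matter.  In the definitions below \<open>I\<close> is meant to be
  \<open>UNIV\<close> or \<open>{0..}\<close>.
\<close>

definition C0_space :: "real set \<Rightarrow> (real \<Rightarrow> 'a::real_normed_vector) set" where
  "C0_space I = {f. continuous_on I f \<and>
     ((\<lambda>t. norm (f t)) \<longlongrightarrow> 0) (inf at_infinity (principal I))}"

definition index_set :: "real set \<Rightarrow> int set" where
  "index_set I = (if I = {0..} then {1..} else UNIV)"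

text \<open>
  The supremum is taken in the extended nonnegative reals, since the family may be
  unbounded for some \<open>n\<close>.
\<close>

definition c_uniformly_recurrent ::
  "real set \<Rightarrow> complex \<Rightarrow> (real \<Rightarrow> 'a::complex_banach) \<Rightarrow> bool" where
  "c_uniformly_recurrent I c f \<longleftrightarrow> continuous_on I f \<and>
     (\<exists>\<alpha>::nat \<Rightarrow> real. strict_mono \<alpha> \<and> (\<forall>n. \<alpha> n > 0) \<and> filterlim \<alpha> at_top sequentially \<and>
        (\<lambda>n. SUP t\<in>I. ennreal (norm (f (t + \<alpha> n) - c *\<^sub>C f t))) \<longlonglongrightarrow> 0)"

definition semi_c_periodic ::
  "real set \<Rightarrow> complex \<Rightarrow> (real \<Rightarrow> 'a::complex_banach) \<Rightarrow> bool" where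
  "semi_c_periodic I c f \<longleftrightarrow> continuous_on I f \<and>
     (\<forall>\<epsilon>>0. \<exists>p>0. \<forall>m\<in>index_set I. \<forall>x\<in>I.
        norm (f (x + of_int m * p) - (c powi m) *\<^sub>C f x) \<le> \<epsilon>)"

end

theory Submission
  imports Defs
begin

text \<open>
  Both hypotheses say that the value \<open>f t\<close>, up to a unimodular factor, is approximated
  with any precision by values \<open>f (t + s)\<close> at arbitrarily large \<open>s\<close>:
  along \<open>s = \<alpha> n\<close> with the factor \<open>c\<close> in the recurrent case, and along
  \<open>s = m p\<close> with the factor \<open>c ^ m\<close> and \<open>m\<close> large in the semi-periodic case. A unimodular
  factor does not change norms, so if \<open>f\<close> vanished at infinity, then \<open>norm (f t)\<close> would be
  arbitrarily small for every \<open>t\<close> in \<open>I\<close>, and \<open>f\<close> would be zero on \<open>I\<close>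
  (\<open>vanishing_if_recurring_values\<close>).
\<close>

lemma C0_space_tendsto_at_top:
  assumes "f \<in> C0_space I" and "{0..} \<subseteq> I"
  shows "((\<lambda>t. norm (f t)) \<longlongrightarrow> 0) at_top"
proof (rule tendsto_mono)
  have "eventually (\<lambda>t. t \<in> I) at_top"
    using eventually_ge_at_top[of "0::real"] by eventually_elim (use assms(2) in auto)
  then show "at_top \<le> inf at_infinity (principal I)"
    by (simp add: at_top_le_at_infinity le_principal)
  show "((\<lambda>t. norm (f t)) \<longlongrightarrow> 0) (inf at_infinity (principal I))"
    using assms(1) by (simp add: C0_space_def)
qed

text \<open>
  The translation \<open>s\<close> and the factor \<open>d\<close> may depend on the precision \<open>e\<close> and on the
  bound \<open>T\<close>. This freedom covers both recurrence and semi-periodicity, where the factors are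
  varying powers of a fixed number.
\<close>

lemma vanishing_if_recurring_values:
  fixes f :: "real \<Rightarrow> 'a::complex_banach"
  assumes lim: "((\<lambda>t. norm (f t)) \<longlongrightarrow> 0) at_top"
    and rec: "\<And>e T. e > 0 \<Longrightarrow>
      \<exists>s\<ge>T. \<exists>d. cmod d = 1 \<and> norm (f (t + s) - d *\<^sub>C f t) \<le> e"
  shows "f t = 0"
proof -
  have "norm (f t) \<le> 0 + e" if e: "e > 0" for e
  proof -
    have "eventually (\<lambda>u. norm (f u) < e / 2) at_top"
      using order_tendstoD(2)[OF lim, of "e / 2"] e by simp
    then obtain U where U: "\<And>u. u \<ge> U \<Longrightarrow> norm (f u) < e / 2"
      by (auto simp: eventually_at_top_linorder)
    obtain s d where s: "s \<ge> U - t" and d: "cmod d = 1"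
      and close: "norm (f (t + s) - d *\<^sub>C f t) \<le> e / 2"
      using rec[of "e / 2" "U - t"] e half_gt_zero by blast
    have "norm (f t) = norm (d *\<^sub>C f t)"
      using d by (simp add: norm_scaleC)
    also have "\<dots> \<le> norm (f (t + s)) + norm (f (t + s) - d *\<^sub>C f t)"
      using norm_triangle_sub[of "d *\<^sub>C f t" "f (t + s)"] by (simp add: norm_minus_commute)
    also have "\<dots> \<le> e"
      using U[of "t + s"] s close by simp
    finally show ?thesis by simp
  qed
  then have "norm (f t) \<le> 0" by (rule field_le_epsilon)
  then show ?thesis by simp
qed

lemma c_uniformly_recurrent_recurring_values:
  fixes f :: "real \<Rightarrow> 'a::complex_banach"
  assumes "c_uniformly_recurrent I c f" and "t \<in> I" and "e > 0"
  shows "\<exists>s\<ge>T. norm (f (t + s) - c *\<^sub>C f t) \<le> e"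
proof -
  obtain \<alpha> :: "nat \<Rightarrow> real" where \<alpha>: "filterlim \<alpha> at_top sequentially"
    and lim: "(\<lambda>n. SUP t\<in>I. ennreal (norm (f (t + \<alpha> n) - c *\<^sub>C f t))) \<longlonglongrightarrow> 0"
    using assms(1) unfolding c_uniformly_recurrent_def by blast
  have "eventually (\<lambda>n. (SUP t\<in>I. ennreal (norm (f (t + \<alpha> n) - c *\<^sub>C f t))) < ennreal e)
    sequentially"
    using order_tendstoD(2)[OF lim, of "ennreal e"] assms(3) by simp
  moreover have "eventually (\<lambda>n. \<alpha> n \<ge> T) sequentially"
    using \<alpha> by (simp add: filterlim_at_top)
  ultimately have "eventually (\<lambda>n. (SUP t\<in>I. ennreal (norm (f (t + \<alpha> n) - c *\<^sub>C f t)))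
      < ennreal e \<and> \<alpha> n \<ge> T) sequentially"
    by (rule eventually_conj)
  then obtain n where n: "(SUP t\<in>I. ennreal (norm (f (t + \<alpha> n) - c *\<^sub>C f t))) < ennreal e"
    and "\<alpha> n \<ge> T"
    by (auto dest: eventually_happens)
  have "ennreal (norm (f (t + \<alpha> n) - c *\<^sub>C f t)) \<le> ennreal e"
    using SUP_upper[OF assms(2), of "\<lambda>t. ennreal (norm (f (t + \<alpha> n) - c *\<^sub>C f t))"] n
    by (meson le_less_trans less_imp_le)
  then have "norm (f (t + \<alpha> n) - c *\<^sub>C f t) \<le> e"
    using assms(3) by (simp add: ennreal_le_iff)
  with \<open>\<alpha> n \<ge> T\<close> show ?thesis by blast
qed

lemma semi_c_periodic_recurring_values:
  fixes f :: "real \<Rightarrow> 'a::complex_banach"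
  assumes "semi_c_periodic I c f" and "t \<in> I" and "e > 0"
  shows "\<exists>s\<ge>T. \<exists>m. norm (f (t + s) - (c powi m) *\<^sub>C f t) \<le> e"
proof -
  obtain p where p: "p > 0"
    and per: "\<And>m x. m \<in> index_set I \<Longrightarrow> x \<in> I \<Longrightarrow>
      norm (f (x + of_int m * p) - (c powi m) *\<^sub>C f x) \<le> e"
    using assms(1,3) unfolding semi_c_periodic_def by blast
  \<comment> \<open>A positive multiplier is admissible for the half-line as well as for the line.\<close>
  define m where "m = max 1 \<lceil>T / p\<rceil>"
  have "m \<in> index_set I" by (simp add: index_set_def m_def)
  moreover have "T / p \<le> of_int m" unfolding m_def by linarith
  then have "T \<le> of_int m * p" using p by (simp add: field_simps)
  ultimately show ?thesis using per[OF _ assms(2)] by blast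
qed

theorem proposition2p18:
  fixes c :: complex and I :: "real set" and f :: "real \<Rightarrow> 'a::complex_banach"
  assumes "cmod c = 1"
    and "I = UNIV \<or> I = {0..}"
    and "\<exists>t\<in>I. f t \<noteq> 0"
    and "c_uniformly_recurrent I c f \<or> semi_c_periodic I c f"
  shows "f \<notin> C0_space I"
proof
  assume "f \<in> C0_space I"
  moreover have "{0..} \<subseteq> I" using assms(2) by auto
  ultimately have lim: "((\<lambda>t. norm (f t)) \<longlongrightarrow> 0) at_top"
    by (rule C0_space_tendsto_at_top)
  obtain t where t: "t \<in> I" "f t \<noteq> 0" using assms(3) by blast
  have "\<exists>s\<ge>T. \<exists>d. cmod d = 1 \<and> norm (f (t + s) - d *\<^sub>C f t) \<le> e" if "e > 0" for e T
    using assms(4)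
  proof
    assume "c_uniformly_recurrent I c f"
    from c_uniformly_recurrent_recurring_values[OF this t(1) that] show ?thesis
      using assms(1) by blast
  next
    assume "semi_c_periodic I c f"
    moreover have "cmod (c powi m) = 1" for m
      using assms(1) by (simp add: norm_power_int)
    ultimately show ?thesis
      using semi_c_periodic_recurring_values[OF _ t(1) that] by blast
  qed
  from vanishing_if_recurring_values[OF lim this] t(2) show False by blast
qed

end
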